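(* There exists a locally checkable problem with round complexity $\Theta(\log\log n)$ in $n$-node graphs in the LOCAL model, and for which the lower bound $\Omega(\log\log n)$ also holds for trees under the randomized online LOCAL model, i.e., every randomized online LOCAL algorithm solving this problem on trees has locality $\Omega(\log\log n)$ on $n$-node trees.
   Context: LOCAL model. The network is a simple connected graph $G=(V,E)$ with $n\ge 1$ nodes. Each node $v$ has an identifier $\mathrm{id}(v)\in[0,N]$, unique in the network, where $N$ is an upper bound on $n$ that is polynomial in $n$; $N$ may be given to the nodes. Initially a node knows only its identifier, its degree and its input label (and $N$), and nothing else about the graph. Computation proceeds in synchronous rounds, all nodes starting at the same round; in each round every node performs arbitrary local computation, sends a message of arbitrary size to each neighbor, and receives its neighbors' messages. Each node eventually outputs a label. The round complexity of a (deterministic) algorithm is the function of $n$ giving the maximum, over all $n$-node graphs (and all identifier and input assignments), of the number of rounds until all nodes have output. Locally checkable problem. A pair $(L,\varphi)$ where $L$ is a finite set of labels and $\varphi$ is a Boolean predicate on $L$-labeled balls of radius $r$ (for some fixed integer $r\ge 0$) in arbitrary graphs (no bound on the degrees); the ball of radius $r$ centered at $v$ is the subgraph induced by the nodes at distance at most $r$ from $v$. Input labels are allowed: $L=L_{in}\times L_{out}$, each node $v$ receives an arbitrary $\ell_{in}(v)\in L_{in}$ and must output $\ell_{out}(v)\in L_{out}$. An algorithm solves the problem if for every input graph and every input labeling the produced labeling is such that the labeled ball of radius $r$ around every node satisfies $\varphi$. A problem has round complexity $\Theta(t(n))$ if some algorithm solves it in $O(t(n))$ rounds and every algorithm solving it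 has round complexity $\Omega(t(n))$. Logarithms are in base $2$. Randomized online LOCAL model. The nodes of the (input-labeled) graph $G$ are processed sequentially according to an order $\sigma=(v_1,\dots,v_n)$ arbitrarily chosen by an adversary (graph, inputs and order being independent of the algorithm's random bits). The algorithm, with locality $d=d(n)\ge 0$, keeps a global memory of the part of the graph discovered so far: at step $i$ it updates its memory to include the part of $G$ (with its input labels) within distance $d$ of $v_i$, and then, based on everything in its memory and on random bits, it must produce an irrevocable output label $\ell_{out}(v_i)$ before proceeding to the next step. A randomized algorithm solves a problem if, on every $n$-node instance and for every order, the resulting labeling is correct with probability at least $1-O(1/n)$. *)

theory Defs
  imports
    "Graph_Theory.Graph_Theory"
    "HOL-Probability.Probability"
    "HOL-Library.Landau_Symbols"
begin

section \<open>Graphs and balls\<close>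

text \<open>
  A finite simple undirected graph is a \<^locale>\<open>pair_graph\<close>: every edge is a pair of opposite arcs.
  Nodes are natural numbers, which is no restriction for finite graphs.
\<close>

type_synonym ngraph = "nat pair_pre_digraph"

definition connected_graph :: "ngraph \<Rightarrow> bool" where
  "connected_graph G \<longleftrightarrow> pair_graph G \<and> Digraph_Component.connected (with_proj G)"

text \<open>
  The predicate \<^const>\<open>Digraph_Component.tree\<close> is not the right notion here: in a symmetric digraph
  the two arcs of an edge already form a directed cycle. Cycles of a simple graph have length at
  least 3.
\<close>

definition tree_graph :: "ngraph \<Rightarrow> bool" where
  "tree_graph G \<longleftrightarrow> connected_graph G \<and>
     \<not> (\<exists>p. pre_digraph.cycle (with_proj G) p \<and> 3 \<le> length p)"

definition ball_nodes :: "ngraph \<Rightarrow> nat \<Rightarrow> nat \<Rightarrow> nat set" where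
  "ball_nodes G r v = {u. \<exists>k\<le>r. (v, u) \<in> parcs G ^^ k}"

definition ball_graph :: "ngraph \<Rightarrow> nat \<Rightarrow> nat \<Rightarrow> ngraph" where
  "ball_graph G r v =
     \<lparr> pverts = ball_nodes G r v,
       parcs = parcs G \<inter> (ball_nodes G r v \<times> ball_nodes G r v) \<rparr>"

section \<open>Locally checkable problems\<close>

text \<open>
  \<^term>\<open>checker P B v \<alpha> \<beta>\<close> is the predicate evaluated on the ball \<^term>\<open>B\<close> with centre \<^term>\<open>v\<close>, input
  labels \<^term>\<open>\<alpha>\<close> and output labels \<^term>\<open>\<beta>\<close>.
\<close>

record problem =
  in_labels :: "nat set"
  out_labels :: "nat set"
  radius :: nat
  checker :: "ngraph \<Rightarrow> nat \<Rightarrow> (nat \<Rightarrow> nat) \<Rightarrow> (nat \<Rightarrow> nat) \<Rightarrow> bool"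

text \<open>
  A predicate on labelled balls may depend neither on the names of the nodes nor on labels outside
  the ball; both are expressed by invariance under isomorphisms of centred labelled graphs.
\<close>

definition labelled_iso ::
  "(nat \<Rightarrow> nat) \<Rightarrow> ngraph \<Rightarrow> nat \<Rightarrow> (nat \<Rightarrow> nat) \<Rightarrow> (nat \<Rightarrow> nat)
     \<Rightarrow> ngraph \<Rightarrow> nat \<Rightarrow> (nat \<Rightarrow> nat) \<Rightarrow> (nat \<Rightarrow> nat) \<Rightarrow> bool" where
  "labelled_iso f G v \<alpha> \<beta> G' v' \<alpha>' \<beta>' \<longleftrightarrow>
     bij_betw f (pverts G) (pverts G') \<and>
     (\<forall>x\<in>pverts G. \<forall>y\<in>pverts G. (x, y) \<in> parcs G \<longleftrightarrow> (f x, f y) \<in> parcs G') \<and>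
     v' = f v \<and>
     (\<forall>x\<in>pverts G. \<alpha>' (f x) = \<alpha> x \<and> \<beta>' (f x) = \<beta> x)"

definition locally_checkable :: "problem \<Rightarrow> bool" where
  "locally_checkable P \<longleftrightarrow>
     finite (in_labels P) \<and> finite (out_labels P) \<and>
     (\<forall>f G v \<alpha> \<beta> G' v' \<alpha>' \<beta>'.
        pair_graph G \<longrightarrow> pair_graph G' \<longrightarrow> v \<in> pverts G \<longrightarrow>
        labelled_iso f G v \<alpha> \<beta> G' v' \<alpha>' \<beta>' \<longrightarrow>
        checker P G v \<alpha> \<beta> = checker P G' v' \<alpha>' \<beta>')"

definition correct :: "problem \<Rightarrow> ngraph \<Rightarrow> (nat \<Rightarrow> nat) \<Rightarrow> (nat \<Rightarrow> nat) \<Rightarrow> bool" where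
  "correct P G \<alpha> \<beta> \<longleftrightarrow>
     (\<forall>v\<in>pverts G. \<beta> v \<in> out_labels P \<and> checker P (ball_graph G (radius P) v) v \<alpha> \<beta>)"

section \<open>The LOCAL model\<close>

text \<open>
  States and messages are natural numbers. This loses no generality: only countably many states and
  messages can ever occur, and the component functions are arbitrary (not necessarily computable).

  \<^item> \<open>init N i \<delta> x\<close> is the initial state of a node with identifier \<open>i\<close>, degree \<open>\<delta>\<close> and input \<open>x\<close>;
  \<^item> \<open>send s j\<close> is the message sent through port \<open>j\<close> (one port per neighbour) in state \<open>s\<close>;
  \<^item> \<open>receive s ms\<close> is the next state, where \<open>ms\<close> lists the received messages by port;
  \<^item> \<open>answer s\<close> is \<^const>\<open>None\<close> as long as the node has not decided.
\<close>

record local_algorithm =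
  init :: "nat \<Rightarrow> nat \<Rightarrow> nat \<Rightarrow> nat \<Rightarrow> nat"
  send :: "nat \<Rightarrow> nat \<Rightarrow> nat"
  receive :: "nat \<Rightarrow> nat list \<Rightarrow> nat"
  answer :: "nat \<Rightarrow> nat option"

text \<open>The list \<open>ports v\<close> enumerates the neighbours of \<open>v\<close>; port \<open>j\<close> of \<open>v\<close> leads to \<open>ports v ! j\<close>.\<close>

record network =
  net_graph :: ngraph
  id_bound :: nat
  ident :: "nat \<Rightarrow> nat"
  ports :: "nat \<Rightarrow> nat list"
  input_label :: "nat \<Rightarrow> nat"

abbreviation nodes :: "network \<Rightarrow> nat set" where
  "nodes I \<equiv> pverts (net_graph I)"

text \<open>
  The parameter \<open>c\<close> fixes the polynomial \<open>c n\<^sup>c\<close> below which the known bound \<open>N\<close> on the number of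
  nodes must lie.
\<close>

definition valid_network :: "nat \<Rightarrow> problem \<Rightarrow> network \<Rightarrow> bool" where
  "valid_network c P I \<longleftrightarrow>
     connected_graph (net_graph I) \<and>
     card (nodes I) \<le> id_bound I \<and> id_bound I \<le> c * card (nodes I) ^ c \<and>
     inj_on (ident I) (nodes I) \<and> (\<forall>v\<in>nodes I. ident I v \<in> {0..id_bound I}) \<and>
     (\<forall>v\<in>nodes I. distinct (ports I v) \<and> set (ports I v) = {u. (v, u) \<in> parcs (net_graph I)}) \<and>
     (\<forall>v\<in>nodes I. input_label I v \<in> in_labels P)"

definition port_to :: "network \<Rightarrow> nat \<Rightarrow> nat \<Rightarrow> nat" where
  "port_to I u v = (LEAST j. j < length (ports I u) \<and> ports I u ! j = v)"

primrec state_after :: "local_algorithm \<Rightarrow> network \<Rightarrow> nat \<Rightarrow> nat \<Rightarrow> nat" where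
  "state_after A I 0 v =
     init A (id_bound I) (ident I v) (out_degree (with_proj (net_graph I)) v) (input_label I v)"
| "state_after A I (Suc t) v =
     receive A (state_after A I t v)
       (map (\<lambda>u. send A (state_after A I t u) (port_to I u v)) (ports I v))"

definition decides :: "local_algorithm \<Rightarrow> network \<Rightarrow> nat \<Rightarrow> bool" where
  "decides A I v \<longleftrightarrow> (\<exists>t. answer A (state_after A I t v) \<noteq> None)"

definition decision_time :: "local_algorithm \<Rightarrow> network \<Rightarrow> nat \<Rightarrow> nat" where
  "decision_time A I v = (LEAST t. answer A (state_after A I t v) \<noteq> None)"

text \<open>The first output is final; a node may go on relaying messages afterwards.\<close>

definition decision :: "local_algorithm \<Rightarrow> network \<Rightarrow> nat \<Rightarrow> nat" where
  "decision A I v = the (answer A (state_after A I (decision_time A I v) v))"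

definition solves_local :: "nat \<Rightarrow> problem \<Rightarrow> local_algorithm \<Rightarrow> bool" where
  "solves_local c P A \<longleftrightarrow>
     (\<forall>I. valid_network c P I \<longrightarrow>
        (\<forall>v\<in>nodes I. decides A I v) \<and> correct P (net_graph I) (input_label I) (decision A I))"

definition rounds :: "local_algorithm \<Rightarrow> network \<Rightarrow> nat" where
  "rounds A I = Max (decision_time A I ` nodes I)"

text \<open>
  Up to isomorphism there are finitely many valid networks with \<open>n\<close> nodes when the input labels are
  finitely many, so that for terminating algorithms the supremum is a maximum.
\<close>

definition round_complexity :: "nat \<Rightarrow> problem \<Rightarrow> local_algorithm \<Rightarrow> nat \<Rightarrow> nat" where
  "round_complexity c P A n =
     Sup {rounds A I | I. valid_network c P I \<and> card (nodes I) = n}"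

definition has_round_complexity :: "nat \<Rightarrow> problem \<Rightarrow> (nat \<Rightarrow> real) \<Rightarrow> bool" where
  "has_round_complexity c P t \<longleftrightarrow>
     (\<exists>A. solves_local c P A \<and> (\<lambda>n. real (round_complexity c P A n)) \<in> O(t)) \<and>
     (\<forall>A. solves_local c P A \<longrightarrow> (\<lambda>n. real (round_complexity c P A n)) \<in> \<Omega>(t))"

section \<open>The randomized online LOCAL model\<close>

text \<open>
  Processing a node reveals the node, the ball around it, and the input labels inside this ball
  (and no others). The global memory is the list of everything revealed so far.
\<close>

type_synonym view = "nat \<times> ngraph \<times> (nat \<Rightarrow> nat option)"

definition view :: "ngraph \<Rightarrow> (nat \<Rightarrow> nat) \<Rightarrow> nat \<Rightarrow> nat \<Rightarrow> view" where
  "view G \<alpha> d v = (v, ball_graph G d v, (\<lambda>u. Some (\<alpha> u)) |` ball_nodes G d v)"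

definition random_bits :: "(nat \<Rightarrow> bool) measure" where
  "random_bits = (\<Pi>\<^sub>M i\<in>UNIV. measure_pmf (bernoulli_pmf (1 / 2)))"

text \<open>
  \<open>A n h \<omega>\<close> is the label given to the node processed last, when the memory is \<open>h\<close> and the random bits
  are \<open>\<omega>\<close>. Earlier outputs are functions of \<open>h\<close> and \<open>\<omega>\<close> as well, and hence available to \<open>A\<close>.
\<close>

type_synonym online_algorithm = "nat \<Rightarrow> view list \<Rightarrow> (nat \<Rightarrow> bool) \<Rightarrow> nat"

definition online_algorithm :: "online_algorithm \<Rightarrow> bool" where
  "online_algorithm A \<longleftrightarrow> (\<forall>n h. A n h \<in> random_bits \<rightarrow>\<^sub>M count_space UNIV)"

definition online_output ::
  "online_algorithm \<Rightarrow> (nat \<Rightarrow> nat) \<Rightarrow> ngraph \<Rightarrow> (nat \<Rightarrow> nat) \<Rightarrow> nat list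
     \<Rightarrow> (nat \<Rightarrow> bool) \<Rightarrow> nat \<Rightarrow> nat" where
  "online_output A d G \<alpha> \<sigma> \<omega> v =
     (let n = card (pverts G)
      in A n (map (view G \<alpha> (d n)) (takeWhile (\<lambda>u. u \<noteq> v) \<sigma> @ [v])) \<omega>)"

definition solves_online ::
  "problem \<Rightarrow> (ngraph \<Rightarrow> bool) \<Rightarrow> online_algorithm \<Rightarrow> (nat \<Rightarrow> nat) \<Rightarrow> bool" where
  "solves_online P graph_class A d \<longleftrightarrow>
     (\<exists>C::real. \<forall>G \<alpha> \<sigma>.
        graph_class G \<longrightarrow> (\<forall>v\<in>pverts G. \<alpha> v \<in> in_labels P) \<longrightarrow>
        distinct \<sigma> \<longrightarrow> set \<sigma> = pverts G \<longrightarrow>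
        measure random_bits
          {\<omega> \<in> space random_bits. correct P G \<alpha> (online_output A d G \<alpha> \<sigma> \<omega>)}
        \<ge> 1 - C / real (card (pverts G)))"

end

theory Submission
  imports Defs
begin

text \<open>
  Call a neighbour \<open>u\<close> of \<open>v\<close> a superior of \<open>v\<close> if \<open>deg u \<ge> 2\<close> and \<open>(deg u)\<^sup>2 \<le> deg v\<close>. A node must
  copy the output of one of its superiors, or its own input bit if it has none. Along a chain of
  superiors the degrees shrink at least like iterated square roots, so in an \<open>n\<close>-node graph every chain
  has length at most about \<open>log log n\<close>, and flooding along superiors solves the problem in that many
  rounds. Conversely, a caterpillar whose spine degrees grow doubly exponentially has a chain of length
  \<open>log log n - O(1)\<close> in which all nodes but the first have a unique superior; the end of the chain must output the
  input bit of its beginning, and before seeing that far neither a deterministic nor a randomized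
  algorithm can guess this bit.
\<close>

section \<open>The copying problem\<close>

definition deg :: "ngraph \<Rightarrow> nat \<Rightarrow> nat" where
  "deg G v = card {u. (v, u) \<in> parcs G}"

definition superiors :: "ngraph \<Rightarrow> nat \<Rightarrow> nat set" where
  "superiors G v = {u. (v, u) \<in> parcs G \<and> 2 \<le> deg G u \<and> (deg G u)\<^sup>2 \<le> deg G v}"

definition copies :: "ngraph \<Rightarrow> nat \<Rightarrow> (nat \<Rightarrow> nat) \<Rightarrow> (nat \<Rightarrow> nat) \<Rightarrow> bool" where
  "copies G v \<alpha> \<beta> \<longleftrightarrow>
     (if superiors G v = {} then \<beta> v = \<alpha> v else \<exists>u\<in>superiors G v. \<beta> v = \<beta> u)"

definition copy_problem :: problem where
  "copy_problem = \<lparr> in_labels = {0, 1}, out_labels = {0, 1}, radius = 2, checker = copies \<rparr>"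

lemma neighbours_iso:
  assumes f: "bij_betw f (pverts G) (pverts G')"
    and arcs: "\<And>x y. x \<in> pverts G \<Longrightarrow> y \<in> pverts G \<Longrightarrow> (x, y) \<in> parcs G \<longleftrightarrow> (f x, f y) \<in> parcs G'"
    and wf: "pair_wf_digraph G" "pair_wf_digraph G'" and v: "v \<in> pverts G"
  shows "{u. (f v, u) \<in> parcs G'} = f ` {u. (v, u) \<in> parcs G}"
proof (intro set_eqI iffI)
  fix y
  assume y: "y \<in> {u. (f v, u) \<in> parcs G'}"
  then have "y \<in> pverts G'"
    using pair_wf_digraph.in_arcsD2[OF wf(2)] by auto
  then obtain x where "x \<in> pverts G" "y = f x"
    using f by (auto simp: bij_betw_def)
  then show "y \<in> f ` {u. (v, u) \<in> parcs G}"
    using y arcs[OF v] by auto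
next
  fix y
  assume "y \<in> f ` {u. (v, u) \<in> parcs G}"
  then show "y \<in> {u. (f v, u) \<in> parcs G'}"
    using arcs[OF v] pair_wf_digraph.in_arcsD2[OF wf(1)] by auto
qed

lemma copies_iso:
  assumes iso: "labelled_iso f G v \<alpha> \<beta> G' v' \<alpha>' \<beta>'"
    and wf: "pair_wf_digraph G" "pair_wf_digraph G'" and v: "v \<in> pverts G"
  shows "copies G v \<alpha> \<beta> \<longleftrightarrow> copies G' v' \<alpha>' \<beta>'"
proof -
  have f: "bij_betw f (pverts G) (pverts G')" and v': "v' = f v"
    and arcs: "\<And>x y. x \<in> pverts G \<Longrightarrow> y \<in> pverts G \<Longrightarrow> (x, y) \<in> parcs G \<longleftrightarrow> (f x, f y) \<in> parcs G'"
    and labels: "\<And>x. x \<in> pverts G \<Longrightarrow> \<alpha>' (f x) = \<alpha> x \<and> \<beta>' (f x) = \<beta> x"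
    using iso by (simp_all add: labelled_iso_def)
  have inj: "inj_on f (pverts G)"
    using f by (simp add: bij_betw_def)
  have nbrs_in: "{u. (x, u) \<in> parcs G} \<subseteq> pverts G" for x
    using pair_wf_digraph.in_arcsD2[OF wf(1)] by auto
  have nbrs: "{u. (f x, u) \<in> parcs G'} = f ` {u. (x, u) \<in> parcs G}" if "x \<in> pverts G" for x
    using neighbours_iso[OF f arcs wf that] by simp
  have deg: "deg G' (f x) = deg G x" if "x \<in> pverts G" for x
    unfolding deg_def nbrs[OF that] by (intro card_image inj_on_subset[OF inj] nbrs_in)
  have "superiors G' v' =
      {u \<in> {u. (f v, u) \<in> parcs G'}. 2 \<le> deg G' u \<and> (deg G' u)\<^sup>2 \<le> deg G' (f v)}"
    by (auto simp: superiors_def v')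
  also have "\<dots> = f ` {u \<in> {u. (v, u) \<in> parcs G}. 2 \<le> deg G u \<and> (deg G u)\<^sup>2 \<le> deg G v}"
    unfolding nbrs[OF v] using nbrs_in[of v] deg v by auto
  finally have "superiors G' v' = f ` superiors G v"
    by (simp add: superiors_def)
  moreover have "superiors G v \<subseteq> pverts G"
    using nbrs_in[of v] by (auto simp: superiors_def)
  ultimately show ?thesis
    using labels v by (auto simp: copies_def v' subset_iff)
qed

lemma locally_checkable_copy_problem: "locally_checkable copy_problem"
proof -
  have "copies G v \<alpha> \<beta> = copies G' v' \<alpha>' \<beta>'"
    if "pair_graph G" "pair_graph G'" "v \<in> pverts G" "labelled_iso f G v \<alpha> \<beta> G' v' \<alpha>' \<beta>'"
    for f G v \<alpha> \<beta> G' v' \<alpha>' \<beta>'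
  proof -
    interpret G: pair_graph G by fact
    interpret G': pair_graph G' by fact
    show ?thesis
      using that G.pair_wf_digraph_axioms G'.pair_wf_digraph_axioms by (intro copies_iso)
  qed
  then show ?thesis
    unfolding locally_checkable_def copy_problem_def problem.simps by blast
qed

lemma ball_nodes_0: "ball_nodes G 0 v = {v}"
  by (auto simp: ball_nodes_def)

lemma ball_nodes_mono: "r \<le> s \<Longrightarrow> ball_nodes G r v \<subseteq> ball_nodes G s v"
  by (auto simp: ball_nodes_def intro: order_trans)

lemma ball_nodes_Suc:
  assumes "(v, u) \<in> parcs G"
  shows "ball_nodes G r u \<subseteq> ball_nodes G (Suc r) v"
proof
  fix w
  assume "w \<in> ball_nodes G r u"
  then obtain k where "k \<le> r" "(u, w) \<in> parcs G ^^ k"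
    by (auto simp: ball_nodes_def)
  then have "Suc k \<le> Suc r" "(v, w) \<in> parcs G ^^ Suc k"
    using assms relpow_Suc_I2[of v u "parcs G" w k] by auto
  then show "w \<in> ball_nodes G (Suc r) v"
    unfolding ball_nodes_def by blast
qed

lemma copies_ball_graph: "copies (ball_graph G 2 v) v \<alpha> \<beta> \<longleftrightarrow> copies G v \<alpha> \<beta>"
proof -
  let ?B = "ball_graph G 2 v"
  have v: "v \<in> ball_nodes G 1 v"
    using ball_nodes_mono[of 0 1 G v] by (simp add: ball_nodes_0)
  have nbr: "w \<in> ball_nodes G (Suc r) u" if "(u, w) \<in> parcs G" for u w r
    using ball_nodes_Suc[OF that, of r] ball_nodes_mono[of 0 r G w] by (auto simp: ball_nodes_0)
  have arcs: "(u, w) \<in> parcs ?B \<longleftrightarrow> (u, w) \<in> parcs G" if "u \<in> ball_nodes G 1 v" for u w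
  proof -
    have "u = v \<or> (v, u) \<in> parcs G"
      using that by (auto simp: ball_nodes_def le_Suc_eq)
    then have "w \<in> ball_nodes G 2 v" if "(u, w) \<in> parcs G"
      using that nbr[of v w 1] ball_nodes_Suc[of v u G 1] nbr[of u w 0]
      by (auto simp: numeral_2_eq_2)
    then show ?thesis
      using that ball_nodes_mono[of 1 2 G v] by (auto simp: ball_graph_def)
  qed
  have nbrs: "{w. (u, w) \<in> parcs ?B} = {w. (u, w) \<in> parcs G}" if "u \<in> ball_nodes G 1 v" for u
    using arcs[OF that] by blast
  have "superiors ?B v = superiors G v"
    using arcs[OF v] nbr[of v _ 0] by (auto simp: superiors_def deg_def nbrs v)
  then show ?thesis
    by (simp add: copies_def)
qed

lemma correct_copy_problem:
  "correct copy_problem G \<alpha> \<beta> \<longleftrightarrow> (\<forall>v\<in>pverts G. \<beta> v \<in> {0, 1} \<and> copies G v \<alpha> \<beta>)"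
  by (auto simp: correct_def copy_problem_def copies_ball_graph)

lemma out_degree_with_proj: "out_degree (with_proj G) v = deg G v"
proof -
  have "out_arcs (with_proj G) v = Pair v ` {u. (v, u) \<in> parcs G}"
    by (auto simp: out_arcs_def)
  then show ?thesis
    by (simp add: out_degree_def deg_def card_image inj_on_def)
qed

text \<open>The components of a state are the degree, the input and the output, if already known.\<close>

fun copy_step ::
  "nat \<times> nat \<times> nat option \<Rightarrow> (nat \<times> nat \<times> nat option) list \<Rightarrow> nat \<times> nat \<times> nat option" where
  "copy_step (\<delta>, x, Some y) ms = (\<delta>, x, Some y)"
| "copy_step (\<delta>, x, None) ms =
     (let ss = filter (\<lambda>m. 2 \<le> fst m \<and> (fst m)\<^sup>2 \<le> \<delta>) ms;
          ds = filter (\<lambda>m. snd (snd m) \<noteq> None) ss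
      in (\<delta>, x, if ss = [] then Some x else if ds = [] then None else snd (snd (hd ds))))"

definition copy_algorithm :: local_algorithm where
  "copy_algorithm =
     \<lparr> init = \<lambda>N i \<delta> x. to_nat (\<delta>, x, None :: nat option),
       send = \<lambda>s j. s,
       receive = \<lambda>s ms. to_nat (copy_step (from_nat s) (map from_nat ms)),
       answer = \<lambda>s. snd (snd (from_nat s :: nat \<times> nat \<times> nat option)) \<rparr>"

abbreviation answer_after :: "network \<Rightarrow> nat \<Rightarrow> nat \<Rightarrow> nat option" where
  "answer_after I t v \<equiv> answer copy_algorithm (state_after copy_algorithm I t v)"

lemma from_nat_state_after:
  "from_nat (state_after copy_algorithm I t v) =
     (deg (net_graph I) v, input_label I v, answer_after I t v)"
proof (induction t arbitrary: v)
  case 0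
  then show ?case
    by (simp add: copy_algorithm_def out_degree_with_proj)
next
  case (Suc t)
  have "fst (copy_step s ms) = fst s" "fst (snd (copy_step s ms)) = fst (snd s)" for s ms
    by (cases "(s, ms)" rule: copy_step.cases; simp add: Let_def)+
  then show ?case
    using Suc[of v] by (simp add: copy_algorithm_def prod_eq_iff)
qed

lemma answer_after_0: "answer_after I 0 v = None"
  by (simp add: copy_algorithm_def)

lemma answer_after_Suc:
  "answer_after I (Suc t) v =
     snd (snd (copy_step (deg (net_graph I) v, input_label I v, answer_after I t v)
       (map (\<lambda>u. (deg (net_graph I) u, input_label I u, answer_after I t u)) (ports I v))))"
proof -
  have "answer_after I (Suc t) v =
     snd (snd (copy_step (from_nat (state_after copy_algorithm I t v))
       (map (\<lambda>u. from_nat (state_after copy_algorithm I t u)) (ports I v))))"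
    by (simp add: copy_algorithm_def comp_def)
  then show ?thesis
    by (simp only: from_nat_state_after)
qed

lemma answer_after_step:
  assumes ports: "set (ports I v) = {u. (v, u) \<in> parcs (net_graph I)}"
  defines "S \<equiv> superiors (net_graph I) v"
  shows "answer_after I t v = Some y \<Longrightarrow> answer_after I (Suc t) v = Some y"
    and "answer_after I t v = None \<Longrightarrow> S = {} \<Longrightarrow> answer_after I (Suc t) v = Some (input_label I v)"
    and "answer_after I t v = None \<Longrightarrow> S \<noteq> {} \<Longrightarrow> answer_after I (Suc t) v = Some y \<Longrightarrow>
           \<exists>u\<in>S. answer_after I t u = Some y"
    and "u \<in> S \<Longrightarrow> answer_after I t u \<noteq> None \<Longrightarrow> answer_after I (Suc t) v \<noteq> None"
proof -
  define ss where "ss =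
    filter (\<lambda>u. 2 \<le> deg (net_graph I) u \<and> (deg (net_graph I) u)\<^sup>2 \<le> deg (net_graph I) v) (ports I v)"
  define ds where "ds = filter (\<lambda>u. answer_after I t u \<noteq> None) ss"
  have ss: "set ss = S"
    using ports by (auto simp: ss_def S_def superiors_def)
  have ds: "set ds = {u \<in> S. answer_after I t u \<noteq> None}"
    by (auto simp: ds_def ss)
  have some: "answer_after I (Suc t) v = Some y" if "answer_after I t v = Some y" for y
    unfolding answer_after_Suc that by simp
  have none: "answer_after I (Suc t) v =
      (if S = {} then Some (input_label I v) else if ds = [] then None else answer_after I t (hd ds))"
    if "answer_after I t v = None"
    unfolding answer_after_Suc that ss[symmetric] set_empty
    by (simp add: filter_map comp_def Let_def ss_def ds_def hd_map del: filter_filter)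
  show "answer_after I t v = Some y \<Longrightarrow> answer_after I (Suc t) v = Some y"
    by (rule some)
  show "answer_after I t v = None \<Longrightarrow> S = {} \<Longrightarrow> answer_after I (Suc t) v = Some (input_label I v)"
    by (subst none) simp_all
  show "\<exists>u\<in>S. answer_after I t u = Some y"
    if "answer_after I t v = None" "S \<noteq> {}" "answer_after I (Suc t) v = Some y"
  proof -
    have "ds \<noteq> []" and "answer_after I t (hd ds) = Some y"
      using that none[OF that(1)] by (auto split: if_splits)
    moreover have "hd ds \<in> S"
      using ds hd_in_set[OF \<open>ds \<noteq> []\<close>] by auto
    ultimately show ?thesis
      by blast
  qed
  show "answer_after I (Suc t) v \<noteq> None" if "u \<in> S" "answer_after I t u \<noteq> None"
  proof (cases "answer_after I t v")
    case None
    have "ds \<noteq> []"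
      using that ds by (metis (mono_tags, lifting) empty_iff list.set(1) mem_Collect_eq)
    then have "hd ds \<in> {u \<in> S. answer_after I t u \<noteq> None}"
      using ds hd_in_set by blast
    then show ?thesis
      using none[OF None] that(1) \<open>ds \<noteq> []\<close> by auto
  next
    case (Some y)
    then show ?thesis
      using some[OF Some] by simp
  qed
qed

section \<open>Correctness and running time of flooding\<close>

lemma valid_networkD:
  assumes "valid_network c P I"
  shows "pair_graph (net_graph I)"
    and "v \<in> nodes I \<Longrightarrow> set (ports I v) = {u. (v, u) \<in> parcs (net_graph I)}"
    and "v \<in> nodes I \<Longrightarrow> distinct (ports I v)"
    and "v \<in> nodes I \<Longrightarrow> u \<in> set (ports I v) \<Longrightarrow> u \<in> nodes I"
    and "finite (nodes I)" and "nodes I \<noteq> {}"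
proof -
  show G: "pair_graph (net_graph I)"
    using assms by (simp add: valid_network_def connected_graph_def)
  interpret pair_graph "net_graph I"
    by (rule G)
  show "finite (nodes I)"
    by (rule pair_finite_verts)
  show "nodes I \<noteq> {}"
    using assms by (auto simp: valid_network_def connected_graph_def Digraph_Component.connected_def
        strongly_connected_def mk_symmetric_def)
  show ports: "v \<in> nodes I \<Longrightarrow> set (ports I v) = {u. (v, u) \<in> parcs (net_graph I)}"
    and "v \<in> nodes I \<Longrightarrow> distinct (ports I v)"
    using assms by (simp_all add: valid_network_def)
  show "v \<in> nodes I \<Longrightarrow> u \<in> set (ports I v) \<Longrightarrow> u \<in> nodes I"
    using ports by (auto dest: in_arcsD2)
qed

lemma deg_less_card:
  assumes "pair_graph G" "v \<in> pverts G"
  shows "deg G v < card (pverts G)"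
proof -
  interpret pair_graph G by fact
  have "{u. (v, u) \<in> parcs G} \<subset> pverts G"
    using assms(2) in_arcsD2 pair_no_loops by fastforce
  then show ?thesis
    unfolding deg_def by (rule psubset_card_mono[OF pair_finite_verts])
qed

lemma square_less_power2_power2:
  assumes "(x::nat)\<^sup>2 \<le> y" "y < 2 ^ 2 ^ Suc j"
  shows "x < 2 ^ 2 ^ j"
proof (rule power_less_imp_less_base)
  show "x\<^sup>2 < (2 ^ 2 ^ j)\<^sup>2"
    using assms by (simp add: mult.commute flip: power_mult)
qed simp

lemma answer_after_mono:
  assumes "valid_network c P I" "v \<in> nodes I" "answer_after I t v = Some y" "t \<le> t'"
  shows "answer_after I t' v = Some y"
  using assms(4)
proof (induction t' rule: dec_induct)
  case (step t')
  then show ?case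
    using answer_after_step(1)[OF valid_networkD(2)[OF assms(1,2)]] by blast
qed (fact assms(3))

lemma superiors_nodes:
  assumes "valid_network c P I" "u \<in> superiors (net_graph I) v"
  shows "u \<in> nodes I"
proof -
  interpret pair_graph "net_graph I"
    using assms(1) by (rule valid_networkD)
  show ?thesis
    using assms(2) by (auto simp: superiors_def dest: in_arcsD2)
qed

lemma answered_after:
  assumes valid: "valid_network c P I" and "v \<in> nodes I" "deg (net_graph I) v < 2 ^ 2 ^ j"
  shows "answer_after I (Suc j) v \<noteq> None"
  using assms(2,3)
proof (induction j arbitrary: v)
  case 0
  have "2 \<le> (x::nat)\<^sup>2" if "2 \<le> x" for x
    using that le_square[of x] unfolding power2_eq_square by linarith
  with 0 have "superiors (net_graph I) v = {}"
    by (fastforce simp: superiors_def)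
  then show ?case
    using answer_after_step(2)[OF valid_networkD(2)[OF valid]] 0 answer_after_0 by (metis option.distinct(1))
next
  case (Suc j)
  note step = answer_after_step[OF valid_networkD(2)[OF valid \<open>v \<in> nodes I\<close>]]
  show ?case
  proof (cases "superiors (net_graph I) v = {}")
    case True
    then have "answer_after I (Suc 0) v = Some (input_label I v)"
      using step(2) answer_after_0 by blast
    from answer_after_mono[OF valid Suc.prems(1) this, of "Suc (Suc j)"] show ?thesis
      by (metis Suc_le_mono le0 option.distinct(1))
  next
    case False
    then obtain u where u: "u \<in> superiors (net_graph I) v"
      by blast
    then have "deg (net_graph I) u < 2 ^ 2 ^ j"
      using Suc.prems(2) square_less_power2_power2 by (auto simp: superiors_def)
    then have "answer_after I (Suc j) u \<noteq> None"
      using Suc.IH superiors_nodes[OF valid u] by blast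
    then show ?thesis
      using step(4) u by blast
  qed
qed

lemma answer_after_decision:
  assumes valid: "valid_network c P I" and v: "v \<in> nodes I"
  shows "decides copy_algorithm I v"
    and "answer_after I t v = Some y \<Longrightarrow> decision copy_algorithm I v = y"
    and "answer_after I (decision_time copy_algorithm I v) v = Some (decision copy_algorithm I v)"
    and "t < decision_time copy_algorithm I v \<Longrightarrow> answer_after I t v = None"
proof -
  have "deg (net_graph I) v < 2 ^ deg (net_graph I) v"
    by simp
  also have "\<dots> \<le> 2 ^ 2 ^ deg (net_graph I) v"
    by (intro power_increasing) (simp_all add: less_imp_le)
  finally have "answer_after I (Suc (deg (net_graph I) v)) v \<noteq> None"
    by (rule answered_after[OF valid v])
  then show dec: "decides copy_algorithm I v"
    unfolding decides_def by blast
  then have "answer_after I (decision_time copy_algorithm I v) v \<noteq> None"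
    unfolding decides_def decision_time_def by (rule LeastI_ex)
  then show final: "answer_after I (decision_time copy_algorithm I v) v = Some (decision copy_algorithm I v)"
    by (auto simp: decision_def)
  show "decision copy_algorithm I v = y" if "answer_after I t v = Some y"
  proof -
    have "decision_time copy_algorithm I v \<le> t"
      unfolding decision_time_def using that by (intro Least_le) simp
    from answer_after_mono[OF valid v final this] show ?thesis
      using that by simp
  qed
  show "answer_after I t v = None" if "t < decision_time copy_algorithm I v"
    using not_less_Least[OF that[unfolded decision_time_def]] by simp
qed

lemma copies_decision:
  assumes valid: "valid_network c P I" and v: "v \<in> nodes I"
  shows "copies (net_graph I) v (input_label I) (decision copy_algorithm I)"
proof -
  note dec = answer_after_decision[OF valid]
  note step = answer_after_step[OF valid_networkD(2)[OF valid v]]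
  obtain t where t: "decision_time copy_algorithm I v = Suc t"
    using dec(3)[OF v] answer_after_0[of I v] by (cases "decision_time copy_algorithm I v") auto
  then have none: "answer_after I t v = None"
    and final: "answer_after I (Suc t) v = Some (decision copy_algorithm I v)"
    using dec(3)[OF v] dec(4)[OF v, of t] unfolding t by (simp_all del: state_after.simps)
  show ?thesis
  proof (cases "superiors (net_graph I) v = {}")
    case True
    then show ?thesis
      using step(2)[OF none True] final by (simp add: copies_def del: state_after.simps)
  next
    case False
    then obtain u where u: "u \<in> superiors (net_graph I) v"
      and "answer_after I t u = Some (decision copy_algorithm I v)"
      using step(3)[OF none False final] by blast
    then have "decision copy_algorithm I u = decision copy_algorithm I v"
      by (intro dec(2) superiors_nodes[OF valid u])
    then show ?thesis
      using u by (auto simp: copies_def intro!: bexI[of _ u])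
  qed
qed

lemma copies_preserves:
  assumes copies: "\<And>v. v \<in> pverts G \<Longrightarrow> copies G v \<alpha> \<beta>"
    and inputs: "\<And>v. v \<in> pverts G \<Longrightarrow> \<alpha> v \<in> L"
    and wf: "pair_wf_digraph G"
  shows "v \<in> pverts G \<Longrightarrow> \<beta> v \<in> L"
proof (induction "deg G v" arbitrary: v rule: less_induct)
  case less
  show ?case
  proof (cases "superiors G v = {}")
    case True
    then show ?thesis
      using copies[OF less.prems] inputs[OF less.prems] by (simp add: copies_def)
  next
    case False
    then obtain u where u: "u \<in> superiors G v" "\<beta> v = \<beta> u"
      using copies[OF less.prems] by (auto simp: copies_def)
    then have "2 \<le> deg G u" "deg G u * deg G u \<le> deg G v" "u \<in> pverts G"
      using pair_wf_digraph.in_arcsD2[OF wf] by (auto simp: superiors_def power2_eq_square)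
    moreover from this have "2 * deg G u \<le> deg G v"
      by (meson mult_le_mono1 order_trans)
    ultimately show ?thesis
      using less.hyps[of u] u(2) by simp
  qed
qed

lemma solves_local_copy_algorithm: "solves_local c copy_problem copy_algorithm"
  unfolding solves_local_def
proof (intro allI impI conjI ballI)
  fix I v
  assume "valid_network c copy_problem I" "v \<in> nodes I"
  then show "decides copy_algorithm I v"
    by (rule answer_after_decision)
next
  fix I
  assume valid: "valid_network c copy_problem I"
  interpret pair_graph "net_graph I"
    using valid by (rule valid_networkD)
  have "input_label I v \<in> {0, 1}" if "v \<in> nodes I" for v
    using valid that by (simp add: valid_network_def copy_problem_def)
  then have "decision copy_algorithm I v \<in> {0, 1}" if "v \<in> nodes I" for v
    using copies_preserves[OF copies_decision[OF valid] _ pair_wf_digraph_axioms that] by blast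
  then show "correct copy_problem (net_graph I) (input_label I) (decision copy_algorithm I)"
    using copies_decision[OF valid] by (simp add: correct_copy_problem)
qed

lemma rounds_copy_algorithm_le:
  assumes valid: "valid_network c P I" and "card (nodes I) \<le> 2 ^ 2 ^ j"
  shows "rounds copy_algorithm I \<le> Suc j"
proof -
  have "decision_time copy_algorithm I v \<le> Suc j" if v: "v \<in> nodes I" for v
  proof -
    have "deg (net_graph I) v < 2 ^ 2 ^ j"
      using deg_less_card[OF valid_networkD(1)[OF valid] v] assms(2) by simp
    then show ?thesis
      unfolding decision_time_def by (intro Least_le answered_after[OF valid v])
  qed
  then show ?thesis
    using valid_networkD(5,6)[OF valid] by (simp add: rounds_def)
qed

lemma round_complexity_copy_algorithm_le:
  assumes "n \<le> 2 ^ 2 ^ j"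
  shows "round_complexity c P copy_algorithm n \<le> Suc j"
proof -
  let ?R = "{rounds copy_algorithm I |I. valid_network c P I \<and> card (nodes I) = n}"
  have "r \<le> Suc j" if "r \<in> ?R" for r
    using that rounds_copy_algorithm_le assms by blast
  then show ?thesis
    unfolding round_complexity_def by (cases "?R = {}") (auto simp only: Sup_nat_empty intro!: cSup_least)
qed

section \<open>Boundedness of the round complexity and indistinguishability\<close>

text \<open>
  Renaming every node to its identifier leaves the run unchanged and leaves only finitely many networks
  of a given size, so that the supremum in \<^const>\<open>round_complexity\<close> is attained.
\<close>

definition named_network :: "nat set \<Rightarrow> nat \<Rightarrow> (nat \<Rightarrow> nat list) \<Rightarrow> (nat \<Rightarrow> nat) \<Rightarrow> network" where
  "named_network V N q x =
     \<lparr> net_graph = \<lparr> pverts = V, parcs = {(i, j). i \<in> V \<and> j \<in> set (q i)} \<rparr>,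
       id_bound = N, ident = (\<lambda>i. i), ports = q, input_label = x \<rparr>"

definition rename_network :: "network \<Rightarrow> network" where
  "rename_network I =
     (let V = ident I ` nodes I; g = inv_into (nodes I) (ident I)
      in named_network V (id_bound I) (\<lambda>i\<in>V. map (ident I) (ports I (g i))) (\<lambda>i\<in>V. input_label I (g i)))"

lemma rename_network_simps:
  assumes "inj_on (ident I) (nodes I)" "v \<in> nodes I"
  shows "nodes (rename_network I) = ident I ` nodes I"
    and "id_bound (rename_network I) = id_bound I"
    and "ident (rename_network I) i = i"
    and "ports (rename_network I) (ident I v) = map (ident I) (ports I v)"
    and "input_label (rename_network I) (ident I v) = input_label I v"
    and "(ident I v, j) \<in> parcs (net_graph (rename_network I)) \<longleftrightarrow> j \<in> ident I ` set (ports I v)"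
  using assms by (simp_all add: rename_network_def named_network_def Let_def inv_into_f_f)

lemma state_after_rename_network:
  assumes valid: "valid_network c P I" and "v \<in> nodes I"
  shows "state_after A (rename_network I) t (ident I v) = state_after A I t v"
  using assms(2)
proof (induction t arbitrary: v)
  have inj: "inj_on (ident I) (nodes I)"
    using valid by (simp add: valid_network_def)
  note simps = rename_network_simps[OF inj]
  note validD = valid_networkD[OF valid]
  {
    case (0 v)
    have "{j. (ident I v, j) \<in> parcs (net_graph (rename_network I))} = ident I ` set (ports I v)"
      using simps(6)[OF 0] by auto
    moreover have "inj_on (ident I) (set (ports I v))"
      using validD(4)[OF 0] by (intro inj_on_subset[OF inj]) auto
    ultimately have "deg (net_graph (rename_network I)) (ident I v) = deg (net_graph I) v"
      using validD(2)[OF 0] by (simp add: deg_def card_image)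
    then show ?case
      using simps[OF 0] by (simp add: out_degree_with_proj)
  next
    case (Suc t v)
    have "port_to (rename_network I) (ident I u) (ident I v) = port_to I u v" if u: "u \<in> nodes I" for u
    proof -
      have "ident I (ports I u ! j) = ident I v \<longleftrightarrow> ports I u ! j = v" if "j < length (ports I u)" for j
        using that Suc.prems validD(4)[OF u] by (intro inj_on_eq_iff[OF inj]) auto
      then have "(j < length (ports I u) \<and> map (ident I) (ports I u) ! j = ident I v) \<longleftrightarrow>
          (j < length (ports I u) \<and> ports I u ! j = v)" for j
        by auto
      then show ?thesis
        unfolding port_to_def simps(4)[OF u] length_map by presburger
    qed
    then have "map (\<lambda>u. send A (state_after A (rename_network I) t u) (port_to (rename_network I) u (ident I v)))
          (ports (rename_network I) (ident I v)) =
        map (\<lambda>u. send A (state_after A I t u) (port_to I u v)) (ports I v)"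
      using Suc.IH validD(4)[OF Suc.prems] unfolding simps(4)[OF Suc.prems] map_map comp_def
      by (intro map_cong) simp_all
    then show ?case
      using Suc.IH[OF Suc.prems] by simp
  }
qed

lemma rounds_rename_network:
  assumes "valid_network c P I"
  shows "rounds A (rename_network I) = rounds A I"
proof -
  have inj: "inj_on (ident I) (nodes I)"
    using assms by (simp add: valid_network_def)
  obtain v where "v \<in> nodes I"
    using valid_networkD(6)[OF assms] by blast
  then have "nodes (rename_network I) = ident I ` nodes I"
    by (rule rename_network_simps[OF inj])
  then show ?thesis
    unfolding rounds_def
    by (simp add: image_image decision_time_def state_after_rename_network[OF assms] cong: image_cong)
qed

lemma finite_rounds:
  assumes "finite (in_labels P)"
  shows "finite {rounds A I |I. valid_network c P I \<and> card (nodes I) = n}"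
proof -
  define M where "M = c * n ^ c"
  define D where "D = (SIGMA V : Pow {..M}. {..M} \<times>
    (V \<rightarrow>\<^sub>E {xs. set xs \<subseteq> {..M} \<and> length xs \<le> n}) \<times> (V \<rightarrow>\<^sub>E in_labels P))"
  have fin: "finite V" if "V \<in> Pow {..M}" for V
    using that finite_subset by blast
  have "finite D"
    unfolding D_def using assms
    by (intro finite_SigmaI finite_cartesian_product finite_PiE finite_lists_length_le) (auto intro: fin)
  moreover have "rounds A I \<in> (\<lambda>(V, N, q, x). rounds A (named_network V N q x)) ` D"
    if valid: "valid_network c P I" and n: "card (nodes I) = n" for I
  proof -
    note validD = valid_networkD[OF valid]
    define V where "V = ident I ` nodes I"
    define g where "g = inv_into (nodes I) (ident I)"
    have inj: "inj_on (ident I) (nodes I)" and N: "id_bound I \<le> M"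
      and ident: "\<And>v. v \<in> nodes I \<Longrightarrow> ident I v \<le> id_bound I"
      and inputs: "\<And>v. v \<in> nodes I \<Longrightarrow> input_label I v \<in> in_labels P"
      using valid n by (auto simp: valid_network_def M_def)
    have ident_le: "ident I v \<le> M" if "v \<in> nodes I" for v
      using ident[OF that] N by simp
    have g: "g i \<in> nodes I" if "i \<in> V" for i
      using that inv_into_into[of i "ident I" "nodes I"] by (simp add: V_def g_def)
    have V_le: "i \<le> M" if "i \<in> V" for i
      using that ident_le by (auto simp: V_def)
    have ports_le: "ident I u \<le> M" if "i \<in> V" "u \<in> set (ports I (g i))" for i u
      using validD(4)[OF g[OF that(1)] that(2)] by (rule ident_le)
    have len: "length (ports I v) \<le> n" if "v \<in> nodes I" for v
      using validD(3,4)[OF that] validD(5) n card_mono[of "nodes I" "set (ports I v)"]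
      by (simp add: distinct_card subset_iff)
    have "(V, id_bound I, \<lambda>i\<in>V. map (ident I) (ports I (g i)), \<lambda>i\<in>V. input_label I (g i)) \<in> D"
      unfolding D_def using N V_le g len ports_le inputs by auto
    moreover have "rounds A I = rounds A (rename_network I)"
      using rounds_rename_network[OF valid] by simp
    ultimately show ?thesis
      unfolding rename_network_def Let_def V_def g_def by force
  qed
  ultimately show ?thesis
    by (elim finite_surj) blast
qed

lemma decision_time_le_round_complexity:
  assumes valid: "valid_network c P I" and "finite (in_labels P)" and v: "v \<in> nodes I"
  shows "decision_time A I v \<le> round_complexity c P A (card (nodes I))"
proof -
  have "decision_time A I v \<le> rounds A I"
    unfolding rounds_def using valid_networkD(5)[OF valid] v by simp
  also have "\<dots> \<le> round_complexity c P A (card (nodes I))"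
    unfolding round_complexity_def using valid
    by (intro cSup_upper bdd_above_finite finite_rounds assms(2)) blast
  finally show ?thesis .
qed

lemma state_after_input_cong:
  assumes "valid_network c P I" "v \<in> nodes I"
    and "\<And>u. u \<in> ball_nodes (net_graph I) t v \<Longrightarrow> \<alpha> u = input_label I u"
  shows "state_after A (I\<lparr>input_label := \<alpha>\<rparr>) t v = state_after A I t v"
  using assms(2,3)
proof (induction t arbitrary: v)
  case 0
  then show ?case
    by (simp add: ball_nodes_0)
next
  case (Suc t)
  have port_to: "port_to (I\<lparr>input_label := \<alpha>\<rparr>) u w = port_to I u w" for u w
    by (simp add: port_to_def)
  have "state_after A (I\<lparr>input_label := \<alpha>\<rparr>) t u = state_after A I t u" if u: "u \<in> set (ports I v)" for u
  proof (rule Suc.IH)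
    show "u \<in> nodes I"
      using valid_networkD(4)[OF assms(1) Suc.prems(1) u] .
    have "(v, u) \<in> parcs (net_graph I)"
      using valid_networkD(2)[OF assms(1) Suc.prems(1)] u by blast
    then show "\<alpha> w = input_label I w" if "w \<in> ball_nodes (net_graph I) t u" for w
      using that Suc.prems(2) ball_nodes_Suc by blast
  qed
  moreover have "state_after A (I\<lparr>input_label := \<alpha>\<rparr>) t v = state_after A I t v"
    using Suc.prems ball_nodes_mono[of t "Suc t" "net_graph I" v] by (intro Suc.IH) auto
  ultimately show ?case
    by (simp add: port_to cong: map_cong)
qed

lemma decision_input_cong:
  assumes valid: "valid_network c P I" "v \<in> nodes I" and dec: "decides A I v"
    and inputs: "\<And>u. u \<in> ball_nodes (net_graph I) (decision_time A I v) v \<Longrightarrow> \<alpha> u = input_label I u"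
  shows "decision A (I\<lparr>input_label := \<alpha>\<rparr>) v = decision A I v"
proof -
  let ?T = "decision_time A I v"
  have states: "state_after A (I\<lparr>input_label := \<alpha>\<rparr>) t v = state_after A I t v" if "t \<le> ?T" for t
    using inputs ball_nodes_mono[OF that, of "net_graph I" v] by (intro state_after_input_cong[OF valid]) auto
  have "answer A (state_after A I ?T v) \<noteq> None"
    using dec unfolding decides_def decision_time_def by (rule LeastI_ex)
  moreover have "answer A (state_after A I t v) = None" if "t < ?T" for t
    using not_less_Least[OF that[unfolded decision_time_def]] by simp
  ultimately have "decision_time A (I\<lparr>input_label := \<alpha>\<rparr>) v = ?T"
    unfolding decision_time_def[of A "I\<lparr>input_label := \<alpha>\<rparr>"]
    by (intro Least_equality) (auto simp: states simp del: state_after.simps intro!: leI)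
  then show ?thesis
    by (simp add: decision_def states)
qed

section \<open>Trees given by a parent function\<close>

definition parent_graph :: "nat \<Rightarrow> (nat \<Rightarrow> nat) \<Rightarrow> ngraph" where
  "parent_graph n p =
     \<lparr> pverts = {..<n},
       parcs = {(x, y). x < n \<and> y < n \<and> (0 < x \<and> y = p x \<or> 0 < y \<and> x = p y)} \<rparr>"

lemma parent_graph_simps:
  "pverts (parent_graph n p) = {..<n}"
  "(x, y) \<in> parcs (parent_graph n p) \<longleftrightarrow>
     x < n \<and> y < n \<and> (0 < x \<and> y = p x \<or> 0 < y \<and> x = p y)"
  by (auto simp: parent_graph_def)

lemma pair_graph_parent_graph:
  assumes "\<And>x. 0 < x \<Longrightarrow> p x < x"
  shows "pair_graph (parent_graph n p)"
proof
  have "parcs (parent_graph n p) \<subseteq> {..<n} \<times> {..<n}"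
    by (auto simp: parent_graph_simps)
  then show "finite (parcs (parent_graph n p))"
    by (rule finite_subset) simp
  show "fst e \<noteq> snd e" if "e \<in> parcs (parent_graph n p)" for e
    using that assms[of "fst e"] assms[of "snd e"] by (cases e) (auto simp: parent_graph_simps)
qed (auto simp: parent_graph_simps symmetric_def sym_def)

lemma mk_symmetric_eq:
  assumes "sym (parcs G)"
  shows "mk_symmetric (with_proj G) = (G :: 'a pair_pre_digraph)"
proof -
  have "(\<Union>e\<in>parcs G. {(fst e, snd e), (snd e, fst e)}) = parcs G"
    using assms by (auto simp: sym_def)
  then show ?thesis
    by (simp add: mk_symmetric_def)
qed

lemma connected_parent_graph:
  assumes p: "\<And>x. 0 < x \<Longrightarrow> p x < x" and "0 < n"
  shows "connected_graph (parent_graph n p)"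
proof -
  let ?G = "parent_graph n p"
  have pg: "pair_graph ?G"
    using p by (rule pair_graph_parent_graph)
  then interpret pair_graph ?G .
  have sym: "sym (parcs ?G)"
    using pair_sym_arcs by (simp add: symmetric_def)
  have root: "reachable (with_proj ?G) x 0 \<and> reachable (with_proj ?G) 0 x" if "x < n" for x
    using that
  proof (induction x rule: less_induct)
    case (less x)
    show ?case
    proof (cases "x = 0")
      case True
      then show ?thesis
        using \<open>0 < n\<close> by (simp add: parent_graph_simps)
    next
      case False
      then have "p x < x" and "(x, p x) \<in> parcs ?G" "(p x, x) \<in> parcs ?G"
        using p[of x] less.prems by (auto simp: parent_graph_simps)
      then show ?thesis
        using less.IH[of "p x"] less.prems
          adj_reachable_trans[of x "p x" 0] reachable_adj_trans[of 0 "p x" x] by simp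
    qed
  qed
  have "strongly_connected (with_proj ?G)"
  proof (rule strongly_connectedI)
    show "verts (with_proj ?G) \<noteq> {}"
      using \<open>0 < n\<close> by (auto simp: parent_graph_simps)
    show "reachable (with_proj ?G) x y"
      if "x \<in> verts (with_proj ?G)" "y \<in> verts (with_proj ?G)" for x y
      using that root reachable_trans[of x 0 y] by (simp add: parent_graph_simps)
  qed
  then show ?thesis
    using pg by (simp add: connected_graph_def Digraph_Component.connected_def mk_symmetric_eq[OF sym])
qed

lemma pawalk_verts_conv: "pcas u q v \<Longrightarrow> pawalk_verts u q = u # map snd q"
  by (induction u q v rule: pcas.induct) auto

lemma pcas_nth:
  assumes "pcas u q v" "i < length q"
  shows "fst (q ! i) = (if i = 0 then u else snd (q ! (i - 1)))"
  using assms by (induction u q v arbitrary: i rule: pcas.induct) (auto simp: nth_Cons')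

lemma pcas_last:
  assumes "pcas u q v" "q \<noteq> []"
  shows "snd (last q) = v"
  using assms by (induction u q v rule: pcas.induct) auto

text \<open>The largest node on a cycle is larger than both of its neighbours there, so both are its parent.\<close>

lemma tree_parent_graph:
  assumes p: "\<And>x. 0 < x \<Longrightarrow> p x < x" and "0 < n"
  shows "tree_graph (parent_graph n p)"
proof -
  let ?G = "parent_graph n p"
  have False if cyc: "pre_digraph.cycle (with_proj ?G) q" and len: "3 \<le> length q" for q
  proof -
    define s where "s i = snd (q ! i)" for i
    define m where "m = length q"
    obtain u where arcs: "set q \<subseteq> parcs ?G" and cas: "pcas u q u"
      and dist: "distinct (tl (pawalk_verts u q))"
      using cyc by (auto simp: pre_digraph.cycle_def pre_digraph.awalk_def
          cas_with_proj_eq awalk_verts_with_proj_eq)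
    have "distinct (map snd q)"
      using dist pawalk_verts_conv[OF cas] by simp
    then have inj: "s i = s j \<longleftrightarrow> i = j" if "i < m" "j < m" for i j
      using that nth_eq_iff_index_eq[of "map snd q" i j] by (simp add: s_def m_def)
    have s_last: "s (m - 1) = u"
      using pcas_last[OF cas] len by (force simp: s_def m_def last_conv_nth)
    define prv where "prv i = (if i = 0 then m - 1 else i - 1)" for i
    define nxt where "nxt i = (if i = m - 1 then 0 else i + 1)" for i
    have step: "(s (prv i), s i) \<in> parcs ?G" if "i < m" for i
    proof -
      have "fst (q ! i) = s (prv i)"
        using pcas_nth[OF cas, of i] that s_last by (auto simp: prv_def s_def m_def)
      moreover have "q ! i \<in> parcs ?G"
        using that arcs by (auto simp: m_def)
      ultimately show ?thesis
        by (cases "q ! i") (simp add: s_def)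
    qed
    obtain j where j: "j < m" and max: "\<And>i. i < m \<Longrightarrow> s i \<le> s j"
    proof -
      have "finite (s ` {..<m})" "s 0 \<in> s ` {..<m}"
        using len by (auto simp: m_def)
      then have "Max (s ` {..<m}) \<in> s ` {..<m}"
        by (intro Max_in) auto
      then obtain j where "j < m" "s j = Max (s ` {..<m})"
        by auto
      then show ?thesis
        using that by simp
    qed
    have idx: "prv j < m" "nxt j < m" "prv j \<noteq> j" "nxt j \<noteq> j" "prv j \<noteq> nxt j" "prv (nxt j) = j"
      using j len by (auto simp: prv_def nxt_def m_def split: if_splits)
    have less: "s (prv j) < s j" "s (nxt j) < s j"
      using max[OF idx(1)] max[OF idx(2)] inj[OF idx(1) j] inj[OF idx(2) j] idx(3,4)
      by (simp_all add: le_less)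
    have "s (prv j) = p (s j)"
      using step[OF j] less(1) p[of "s (prv j)"] by (auto simp: parent_graph_simps)
    moreover have "s (nxt j) = p (s j)"
      using step[OF idx(2)] idx(6) less(2) p[of "s (nxt j)"] by (auto simp: parent_graph_simps)
    ultimately show False
      using inj[OF idx(1,2)] idx(5) by simp
  qed
  then show ?thesis
    using connected_parent_graph[of p n, OF assms] by (auto simp: tree_graph_def)
qed

section \<open>Caterpillars with doubly exponential degrees\<close>

fun spine :: "nat \<Rightarrow> nat" where
  "spine 0 = 0"
| "spine (Suc 0) = 1"
| spine_Suc_Suc: "spine (Suc (Suc i)) = 4 * (spine (Suc i))\<^sup>2"

declare spine_Suc_Suc [simp del]

lemma spine_pos: "0 < spine (Suc i)"
  by (induction i) (simp_all add: spine_Suc_Suc)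

lemma strict_mono_spine: "strict_mono spine"
proof (rule strict_monoI_Suc)
  fix i
  show "spine i < spine (Suc i)"
  proof (cases i)
    case (Suc j)
    have "1 * spine i < 4 * spine i * spine i"
      using spine_pos[of j] Suc by (intro mult_strict_right_mono) simp_all
    then show ?thesis
      by (simp add: Suc spine_Suc_Suc power2_eq_square)
  qed simp
qed

lemmas spine_less_iff = strict_mono_less[OF strict_mono_spine]
lemmas spine_le_iff = strict_mono_less_eq[OF strict_mono_spine]
lemmas spine_eq_iff = strict_mono_eq[OF strict_mono_spine]

lemma spine_le_power: "4 * spine (Suc i) \<le> 2 ^ 2 ^ Suc i"
proof (induction i)
  case (Suc i)
  have "4 * spine (Suc (Suc i)) = (4 * spine (Suc i))\<^sup>2"
    by (simp add: spine_Suc_Suc power_mult_distrib)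
  also have "\<dots> \<le> (2 ^ 2 ^ Suc i)\<^sup>2"
    using Suc by (rule power_mono) simp
  also have "\<dots> = 2 ^ 2 ^ Suc (Suc i)"
    by (simp add: mult.commute flip: power_mult)
  finally show ?case .
qed simp

text \<open>
  The nodes of level \<open>1 \<le> i \<le> k\<close> are those from \<open>spine i\<close> up to \<open>spine (i + 1)\<close>; all of them are children of
  \<open>spine (i - 1)\<close>. Level \<open>k + 1\<close> takes all remaining nodes.
\<close>

definition level :: "nat \<Rightarrow> nat \<Rightarrow> nat" where
  "level k x = Max {i. i \<le> Suc k \<and> spine i \<le> x}"

definition parent :: "nat \<Rightarrow> nat \<Rightarrow> nat" where
  "parent k x = spine (level k x - 1)"

abbreviation spine_tree :: "nat \<Rightarrow> nat \<Rightarrow> ngraph" where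
  "spine_tree k n \<equiv> parent_graph n (parent k)"

lemma level_in: "level k x \<le> Suc k" "spine (level k x) \<le> x"
proof -
  have "level k x \<in> {i. i \<le> Suc k \<and> spine i \<le> x}"
    unfolding level_def by (rule Max_in) (auto intro: exI[of _ 0])
  then show "level k x \<le> Suc k" "spine (level k x) \<le> x"
    by auto
qed

lemma le_level_iff:
  assumes "i \<le> Suc k"
  shows "i \<le> level k x \<longleftrightarrow> spine i \<le> x"
proof
  assume "i \<le> level k x"
  then have "spine i \<le> spine (level k x)"
    by (simp add: spine_le_iff)
  then show "spine i \<le> x"
    using level_in(2) by (rule order_trans)
next
  assume "spine i \<le> x"
  then show "i \<le> level k x"
    unfolding level_def using assms by (intro Max_ge) auto
qed

lemma level_pos: "0 < x \<Longrightarrow> 0 < level k x"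
  using le_level_iff[of 1 k x] by simp

lemma level_spine: "i \<le> Suc k \<Longrightarrow> level k (spine i) = i"
  using le_level_iff[of i k "spine i"] level_in(2)[of k "spine i"] by (simp add: spine_le_iff)

lemma parent_less: "0 < x \<Longrightarrow> parent k x < x"
  using level_in(2)[of k x] level_pos[of x k] spine_less_iff[of "level k x - 1" "level k x"]
  by (simp add: parent_def)

lemma level_parent: "level k (parent k x) = level k x - 1"
  using level_in(1)[of k x] by (simp add: parent_def level_spine)

lemma arc_cases:
  assumes "(x, y) \<in> parcs (spine_tree k n)"
  obtains "0 < x" "y = parent k x" "level k x = Suc (level k y)"
  | "0 < y" "x = parent k y" "level k y = Suc (level k x)"
  using assms level_pos[of x k] level_pos[of y k] level_parent[of k x] level_parent[of k y]
  by (auto simp: parent_graph_simps)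

lemma level_relpow:
  "(x, y) \<in> parcs (spine_tree k n) ^^ m \<Longrightarrow> level k x \<le> level k y + m"
proof (induction m arbitrary: y)
  case (Suc m)
  then obtain z where "(x, z) \<in> parcs (spine_tree k n) ^^ m" "(z, y) \<in> parcs (spine_tree k n)"
    by auto
  then have "level k x \<le> level k z + m" "level k z \<le> Suc (level k y)"
    using Suc.IH by (auto elim: arc_cases)
  then show ?case
    by simp
qed simp

lemma root_notin_ball:
  assumes "d < k"
  shows "0 \<notin> ball_nodes (spine_tree k n) d (spine k)"
proof
  assume "0 \<in> ball_nodes (spine_tree k n) d (spine k)"
  then obtain m where "m \<le> d" "(spine k, 0) \<in> parcs (spine_tree k n) ^^ m"
    by (auto simp: ball_nodes_def)
  then show False
    using level_relpow level_spine[of k k] level_spine[of 0 k] assms by fastforce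
qed

lemma child_iff:
  assumes "i \<le> k"
  shows "0 < y \<and> parent k y = spine i \<longleftrightarrow> spine (Suc i) \<le> y \<and> (i < k \<longrightarrow> y < spine (Suc (Suc i)))"
proof -
  have "0 < y \<and> parent k y = spine i \<longleftrightarrow> 0 < y \<and> level k y = Suc i"
    using level_pos[of y k] by (auto simp: parent_def spine_eq_iff)
  also have "\<dots> \<longleftrightarrow> level k y = Suc i"
    using level_spine[of 0 k] by (cases y) auto
  also have "\<dots> \<longleftrightarrow> Suc i \<le> level k y \<and> (i < k \<longrightarrow> \<not> Suc (Suc i) \<le> level k y)"
    using level_in(1)[of k y] assms by auto
  also have "\<dots> \<longleftrightarrow> spine (Suc i) \<le> y \<and> (i < k \<longrightarrow> \<not> spine (Suc (Suc i)) \<le> y)"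
    using assms le_level_iff[of "Suc i" k y] le_level_iff[of "Suc (Suc i)" k y]
    by (auto)
  finally show ?thesis
    by (simp add: not_le)
qed

lemma finite_neighbours: "finite {u. (v, u) \<in> parcs (spine_tree k n)}"
  by (rule finite_subset[of _ "{..<n}"]) (auto simp: parent_graph_simps)

lemma deg_off_spine:
  assumes "u \<notin> spine ` {..k}"
  shows "deg (spine_tree k n) u \<le> 1"
proof -
  have "u \<noteq> parent k y" for y
    using assms level_in(1)[of k y] by (auto simp: parent_def)
  then have "{w. (u, w) \<in> parcs (spine_tree k n)} \<subseteq> {parent k u}"
    by (auto simp: parent_graph_simps)
  then show ?thesis
    unfolding deg_def using card_mono[of "{parent k u}"] by auto
qed

lemma deg_spine_ge:
  assumes "i \<le> k" and n: "spine (Suc (Suc k)) \<le> n"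
  shows "spine (Suc (Suc i)) - spine (Suc i) \<le> deg (spine_tree k n) (spine i)"
proof -
  have le: "spine (Suc (Suc i)) \<le> n" "spine i < spine (Suc (Suc i))"
    using assms spine_le_iff[of "Suc (Suc i)" "Suc (Suc k)"] by (simp_all add: spine_less_iff)
  have "(spine i, u) \<in> parcs (spine_tree k n)" if "spine (Suc i) \<le> u" "u < spine (Suc (Suc i))" for u
    using le that child_iff[OF assms(1), of u] by (simp add: parent_graph_simps)
  then have "{spine (Suc i)..<spine (Suc (Suc i))} \<subseteq> {u. (spine i, u) \<in> parcs (spine_tree k n)}"
    by auto
  from card_mono[OF finite_neighbours this] show ?thesis
    by (simp add: deg_def)
qed

lemma deg_spine_le:
  assumes "i < k"
  shows "deg (spine_tree k n) (spine i) \<le> spine (Suc (Suc i))"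
proof -
  let ?A = "{spine (Suc i)..<spine (Suc (Suc i))}"
  have "u = parent k (spine i) \<or> u \<in> ?A" if "(spine i, u) \<in> parcs (spine_tree k n)" for u
    using that child_iff[of i k u] assms by (auto simp: parent_graph_simps)
  then have "{u. (spine i, u) \<in> parcs (spine_tree k n)} \<subseteq> insert (parent k (spine i)) ?A"
    by blast
  then have "deg (spine_tree k n) (spine i) \<le> card (insert (parent k (spine i)) ?A)"
    unfolding deg_def by (intro card_mono) auto
  also have "\<dots> \<le> Suc (card ?A)"
    by (rule card_insert_le_m1) auto
  also have "\<dots> \<le> spine (Suc (Suc i))"
    using spine_pos[of i] spine_less_iff[of "Suc i" "Suc (Suc i)"] by simp
  finally show ?thesis .
qed

lemma deg_spine_ge_2:
  assumes "i \<le> k" and n: "spine (Suc (Suc k)) \<le> n"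
  shows "2 \<le> deg (spine_tree k n) (spine i)"
proof -
  define A where "A = spine (Suc i)"
  have "1 \<le> A"
    using spine_pos[of i] by (simp add: A_def)
  then have "A + 2 \<le> 4 * A\<^sup>2"
    using le_square[of A] unfolding power2_eq_square by linarith
  then show ?thesis
    using deg_spine_ge[OF assms] by (simp add: spine_Suc_Suc flip: A_def)
qed

lemma deg_spine_square_le:
  assumes "i < k" and n: "spine (Suc (Suc k)) \<le> n"
  shows "(deg (spine_tree k n) (spine i))\<^sup>2 \<le> deg (spine_tree k n) (spine (Suc i))"
proof -
  define A where "A = spine (Suc (Suc i))"
  have "(deg (spine_tree k n) (spine i))\<^sup>2 \<le> A\<^sup>2"
    using deg_spine_le[OF assms(1)] by (simp add: A_def power_mono)
  also have "A\<^sup>2 \<le> 4 * A\<^sup>2 - A"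
    using le_square[of A] unfolding power2_eq_square by linarith
  also have "\<dots> \<le> deg (spine_tree k n) (spine (Suc i))"
    using deg_spine_ge[of "Suc i" k n] assms spine_Suc_Suc[of "Suc i"]
    by (simp add: A_def)
  finally show ?thesis .
qed

lemma superiors_spine:
  assumes "i \<le> k" and n: "spine (Suc (Suc k)) \<le> n"
  shows "superiors (spine_tree k n) (spine i) = (if i = 0 then {} else {spine (i - 1)})"
proof -
  let ?G = "spine_tree k n"
  have down: "\<exists>j. i = Suc j \<and> u = spine j" if u: "u \<in> superiors ?G (spine i)" for u
  proof -
    have arc: "(spine i, u) \<in> parcs ?G" and "2 \<le> deg ?G u"
      and sq: "(deg ?G u)\<^sup>2 \<le> deg ?G (spine i)"
      using u by (auto simp: superiors_def)
    then obtain j where j: "j \<le> k" "u = spine j"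
      using deg_off_spine[of u k n] by (cases "u \<in> spine ` {..k}") auto
    have "i = Suc j \<or> j = Suc i"
      using arc level_spine[of i k] level_spine[of j k] assms(1) j by (auto elim: arc_cases)
    moreover have False if "j = Suc i"
    proof -
      define D where "D = deg ?G (spine i)"
      have "2 \<le> D" "D\<^sup>2 \<le> deg ?G u"
        using deg_spine_ge_2[OF assms] deg_spine_square_le[of i k n] j n that
        by (simp_all add: D_def)
      moreover have "deg ?G u \<le> (deg ?G u)\<^sup>2"
        by (simp add: power2_eq_square)
      ultimately have "D\<^sup>2 \<le> D"
        using sq by (simp add: D_def)
      then show False
        using \<open>2 \<le> D\<close> by (simp add: power2_eq_square)
    qed
    ultimately show ?thesis
      using j by blast
  qed
  have up: "spine j \<in> superiors ?G (spine i)" if "i = Suc j" for j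
  proof -
    have "spine i < n"
      using n spine_less_iff[of i "Suc (Suc k)"] assms(1) by simp
    then have "(spine i, spine j) \<in> parcs ?G"
      using child_iff[of j k "spine i"] spine_less_iff[of j i] spine_less_iff[of i "Suc i"] that assms(1)
      by (simp add: parent_graph_simps)
    then show ?thesis
      using deg_spine_ge_2[of j k n] deg_spine_square_le[of j k n] assms that
      by (simp add: superiors_def)
  qed
  show ?thesis
  proof (cases i)
    case 0
    then show ?thesis
      using down by fastforce
  next
    case (Suc j)
    then have "superiors ?G (spine i) \<subseteq> {spine j}"
      using down by fastforce
    then show ?thesis
      using up[OF Suc] Suc by auto
  qed
qed

lemma correct_on_spine:
  assumes "correct copy_problem (spine_tree k n) \<alpha> \<beta>" "spine (Suc (Suc k)) \<le> n" "i \<le> k"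
  shows "\<beta> (spine i) = \<alpha> 0"
  using assms(3)
proof (induction i)
  case 0
  have "0 < n"
    using assms(2) spine_pos[of "Suc k"] by linarith
  then show ?case
    using assms(1) superiors_spine[OF 0 assms(2)]
    by (simp add: correct_copy_problem copies_def parent_graph_simps)
next
  case (Suc i)
  have "spine (Suc i) < n"
    using assms(2) Suc.prems spine_less_iff[of "Suc i" "Suc (Suc k)"] by simp
  then have "copies (spine_tree k n) (spine (Suc i)) \<alpha> \<beta>"
    using assms(1) by (simp add: correct_copy_problem parent_graph_simps)
  then have "\<beta> (spine (Suc i)) = \<beta> (spine i)"
    using superiors_spine[OF Suc.prems assms(2)] by (simp add: copies_def)
  then show ?case
    using Suc by simp
qed

lemma chain_tree:
  assumes "2 ^ 2 ^ (k + 2) \<le> n"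
  obtains G w where "tree_graph G" "pverts G = {..<n}" "0 < n" "w < n"
    "\<And>d. d < k \<Longrightarrow> 0 \<notin> ball_nodes G d w"
    "\<And>\<alpha> \<beta>. correct copy_problem G \<alpha> \<beta> \<Longrightarrow> \<beta> w = \<alpha> 0"
proof
  have le: "spine (Suc (Suc k)) \<le> n"
    using assms spine_le_power[of "Suc k"] by simp
  show "0 < n" and "spine k < n"
    using le spine_less_iff[of k "Suc (Suc k)"] by simp_all
  then show "tree_graph (spine_tree k n)"
    by (intro tree_parent_graph parent_less)
  show "pverts (spine_tree k n) = {..<n}"
    by (simp add: parent_graph_simps)
  show "0 \<notin> ball_nodes (spine_tree k n) d (spine k)" if "d < k" for d
    using that by (rule root_notin_ball)
  show "\<beta> (spine k) = \<alpha> 0" if "correct copy_problem (spine_tree k n) \<alpha> \<beta>" for \<alpha> \<beta>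
    using correct_on_spine[OF that le] by simp
qed

section \<open>Lower bounds\<close>

lemma loglog_less_iff:
  fixes x :: real
  assumes "1 < x"
  shows "log 2 (log 2 x) < real j \<longleftrightarrow> x < 2 ^ 2 ^ j"
proof -
  have "log 2 (log 2 x) < real j \<longleftrightarrow> log 2 x < 2 ^ j"
    using assms by (simp add: log_less_iff powr_realpow)
  also have "\<dots> \<longleftrightarrow> x < 2 powr (2 ^ j)"
    using assms by (simp add: log_less_iff)
  also have "(2::real) powr (2 ^ j) = 2 ^ 2 ^ j"
    using powr_realpow[of 2 "2 ^ j"] by simp
  finally show ?thesis .
qed

lemma le_loglog_iff:
  assumes "2 \<le> n"
  shows "real j \<le> log 2 (log 2 (real n)) \<longleftrightarrow> 2 ^ 2 ^ j \<le> n"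
  using loglog_less_iff[of "real n" j] assms of_nat_le_iff[of "2 ^ 2 ^ j" n, where 'a = real]
  by (simp add: not_less[symmetric] del: of_nat_le_iff)

lemma le_power2_power2_ceiling_loglog:
  assumes "2 \<le> n"
  shows "n \<le> 2 ^ 2 ^ nat \<lceil>log 2 (log 2 (real n))\<rceil>"
proof (rule ccontr)
  define j where "j = nat \<lceil>log 2 (log 2 (real n))\<rceil>"
  assume "\<not> n \<le> 2 ^ 2 ^ nat \<lceil>log 2 (log 2 (real n))\<rceil>"
  then have "\<not> real n \<le> real (2 ^ 2 ^ j)"
    unfolding of_nat_le_iff j_def .
  then have gt: "2 ^ 2 ^ j < real n"
    by simp
  then have "2 ^ j < log 2 (real n)"
    using less_log_iff[of 2 "real n" "2 ^ j"] powr_realpow[of 2 "2 ^ j"] assms by simp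
  then have "real j < log 2 (log 2 (real n))"
    by (subst less_log_iff) (auto simp: powr_realpow intro: less_trans[of 0 "2 ^ j"])
  then show False
    by (simp add: j_def) linarith
qed

lemma eventually_le_loglog: "eventually (\<lambda>n. 2 \<le> n \<and> real j \<le> log 2 (log 2 (real n))) sequentially"
proof (rule eventually_sequentiallyI)
  fix n :: nat
  assume "2 ^ 2 ^ j \<le> n"
  moreover have "(2::nat) ^ 1 \<le> 2 ^ 2 ^ j"
    by (intro power_increasing) simp_all
  ultimately show "2 \<le> n \<and> real j \<le> log 2 (log 2 (real n))"
    by (simp add: le_loglog_iff)
qed

lemma bigomega_loglogI:
  fixes f :: "nat \<Rightarrow> nat"
  assumes "eventually (\<lambda>n. \<forall>k. 2 ^ 2 ^ (k + 2) \<le> n \<longrightarrow> k \<le> f n) sequentially"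
  shows "(\<lambda>n. real (f n)) \<in> \<Omega>(\<lambda>n. log 2 (log 2 (real n)))"
proof (rule landau_omega.bigI)
  show "eventually (\<lambda>n. norm (real (f n)) \<ge> 1 / 2 * norm (log 2 (log 2 (real n)))) sequentially"
    using assms eventually_le_loglog[of 6]
  proof eventually_elim
    case (elim n)
    define y where "y = log 2 (log 2 (real n))"
    define k where "k = nat \<lfloor>y\<rfloor> - 2"
    have "6 \<le> y"
      using elim(2) by (simp add: y_def)
    then have k: "real (k + 2) \<le> y" "y \<le> 2 * real k"
      unfolding k_def by linarith+
    then have "2 ^ 2 ^ (k + 2) \<le> n"
      using elim(2) le_loglog_iff[of n "k + 2"] by (simp add: y_def)
    then have "k \<le> f n"
      using elim(1) by blast
    then show ?case
      using k(2) \<open>6 \<le> y\<close> by (simp flip: y_def)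
  qed
qed simp

lemma bigo_loglogI:
  fixes f :: "nat \<Rightarrow> nat"
  assumes "\<And>n j. n \<le> 2 ^ 2 ^ j \<Longrightarrow> f n \<le> Suc j"
  shows "(\<lambda>n. real (f n)) \<in> O(\<lambda>n. log 2 (log 2 (real n)))"
proof (rule landau_o.bigI)
  show "eventually (\<lambda>n. norm (real (f n)) \<le> 3 * norm (log 2 (log 2 (real n)))) sequentially"
    using eventually_le_loglog[of 1]
  proof eventually_elim
    case (elim n)
    define y where "y = log 2 (log 2 (real n))"
    have "f n \<le> Suc (nat \<lceil>y\<rceil>)"
      using elim by (intro assms) (simp add: y_def le_power2_power2_ceiling_loglog)
    moreover have "1 \<le> y"
      using elim by (simp add: y_def)
    ultimately show ?case
      unfolding y_def[symmetric] real_norm_def by linarith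
  qed
qed simp

lemma le_round_complexity:
  assumes A: "solves_local c copy_problem A" and "1 \<le> c" and n: "2 ^ 2 ^ (k + 2) \<le> n"
  shows "k \<le> round_complexity c copy_problem A n"
proof -
  obtain G w where G: "tree_graph G" "pverts G = {..<n}" and "0 < n" "w < n"
    and far: "\<And>d. d < k \<Longrightarrow> 0 \<notin> ball_nodes G d w"
    and forced: "\<And>\<alpha> \<beta>. correct copy_problem G \<alpha> \<beta> \<Longrightarrow> \<beta> w = \<alpha> 0"
    using chain_tree[OF n] by blast
  define I where "I b = \<lparr> net_graph = G, id_bound = n, ident = (\<lambda>v. v),
    ports = (\<lambda>v. sorted_list_of_set {u. (v, u) \<in> parcs G}), input_label = (\<lambda>v. if v = 0 then b else 0) \<rparr>"
    for b :: nat
  interpret pair_graph G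
    using G(1) by (simp add: tree_graph_def connected_graph_def)
  have "finite {u. (v, u) \<in> parcs G}" for v
    by (rule finite_subset[OF _ pair_finite_verts]) (auto dest: in_arcsD2)
  moreover have "n \<le> c * n ^ c"
    using mult_le_mono[OF \<open>1 \<le> c\<close> power_increasing[OF \<open>1 \<le> c\<close>, of n]] \<open>0 < n\<close> by simp
  ultimately have valid: "valid_network c copy_problem (I b)" if "b \<in> {0, 1}" for b
    using that G by (auto simp: valid_network_def I_def copy_problem_def tree_graph_def)
  have dec: "decides A (I b) w" and forced_I: "decision A (I b) w = b" if "b \<in> {0, 1}" for b
    using A valid[OF that] forced[of "input_label (I b)"] \<open>w < n\<close>
    by (auto simp: solves_local_def I_def G(2))
  have "k \<le> decision_time A (I 0) w"
  proof (rule ccontr)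
    assume "\<not> k \<le> decision_time A (I 0) w"
    then have unseen: "0 \<notin> ball_nodes G (decision_time A (I 0) w) w"
      by (intro far) simp
    have "decision A ((I 0)\<lparr>input_label := input_label (I 1)\<rparr>) w = decision A (I 0) w"
    proof (rule decision_input_cong)
      show "valid_network c copy_problem (I 0)" "decides A (I 0) w"
        by (simp_all add: valid dec)
      show "w \<in> nodes (I 0)"
        using \<open>w < n\<close> by (simp add: I_def G(2))
      fix u
      assume "u \<in> ball_nodes (net_graph (I 0)) (decision_time A (I 0) w) w"
      moreover have "net_graph (I 0) = G"
        by (simp add: I_def)
      ultimately have "u \<noteq> 0"
        using unseen by metis
      then show "input_label (I 1) u = input_label (I 0) u"
        by (simp add: I_def)
    qed
    moreover have "(I 0)\<lparr>input_label := input_label (I 1)\<rparr> = I 1"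
      by (simp add: I_def)
    ultimately show False
      using forced_I[of 0] forced_I[of 1] by simp
  qed
  also have "\<dots> \<le> round_complexity c copy_problem A (card (nodes (I 0)))"
    using \<open>w < n\<close> by (intro decision_time_le_round_complexity valid) (simp_all add: copy_problem_def I_def G(2))
  finally show ?thesis
    by (simp add: I_def G(2))
qed

lemma in_labels_copy_problem: "in_labels copy_problem = {0, 1}"
  by (simp add: copy_problem_def)

lemma prob_space_random_bits: "prob_space random_bits"
  unfolding random_bits_def by (intro prob_space_PiM measure_pmf.prob_space_axioms)

text \<open>
  The adversary asks for the end of the chain first: below distance \<open>k\<close> the algorithm does not see the
  input of node 0, and its first answer cannot be probably right for both values of this input.
\<close>

lemma le_online_locality:
  assumes A: "online_algorithm A" and C: "\<And>G \<alpha> \<sigma>. tree_graph G \<Longrightarrow> \<forall>v\<in>pverts G. \<alpha> v \<in> {0, 1} \<Longrightarrow>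
      distinct \<sigma> \<Longrightarrow> set \<sigma> = pverts G \<Longrightarrow>
      1 - C / real (card (pverts G)) \<le> measure random_bits
        {\<omega> \<in> space random_bits. correct copy_problem G \<alpha> (online_output A d G \<alpha> \<sigma> \<omega>)}"
    and "2 * C < real n" and n: "2 ^ 2 ^ (k + 2) \<le> n"
  shows "k \<le> d n"
proof (rule ccontr)
  assume "\<not> k \<le> d n"
  obtain G w where G: "tree_graph G" "pverts G = {..<n}" and "0 < n" "w < n"
    and far: "\<And>d. d < k \<Longrightarrow> 0 \<notin> ball_nodes G d w"
    and forced: "\<And>\<alpha> \<beta>. correct copy_problem G \<alpha> \<beta> \<Longrightarrow> \<beta> w = \<alpha> 0"
    using chain_tree[OF n] by blast
  interpret prob_space random_bits
    by (rule prob_space_random_bits)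
  define \<alpha> where "\<alpha> b v = (if v = 0 then b else 0)" for b v :: nat
  define \<sigma> where "\<sigma> = w # sorted_list_of_set ({..<n} - {w})"
  define f where "f = A n [view G (\<alpha> 0) (d n) w]"
  define E where "E b = {\<omega> \<in> space random_bits. f \<omega> = b}" for b
  have same: "view G (\<alpha> b) (d n) w = view G (\<alpha> 0) (d n) w" for b
    using far[of "d n"] \<open>\<not> k \<le> d n\<close> by (auto simp: view_def restrict_map_def \<alpha>_def)
  have first: "online_output A d G (\<alpha> b) \<sigma> \<omega> w = f \<omega>" for b \<omega>
    by (simp add: online_output_def \<sigma>_def f_def G(2) same[of b])
  have f: "f \<in> random_bits \<rightarrow>\<^sub>M count_space UNIV"
    using A by (simp add: online_algorithm_def f_def)
  have E: "E b \<in> sets random_bits" for b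
    using measurable_sets[OF f, of "{b}"] by (simp add: E_def vimage_def Int_def conj_commute)
  have half: "1 / 2 < measure random_bits (E b)" if b: "b \<in> {0, 1}" for b
  proof -
    have "1 / 2 < 1 - C / real n"
      using \<open>2 * C < real n\<close> \<open>0 < n\<close> by (simp add: field_simps)
    also have "\<dots> \<le> measure random_bits
        {\<omega> \<in> space random_bits. correct copy_problem G (\<alpha> b) (online_output A d G (\<alpha> b) \<sigma> \<omega>)}"
      using C[of G "\<alpha> b" \<sigma>] G b \<open>w < n\<close> by (auto simp: \<alpha>_def \<sigma>_def insert_absorb)
    also have "\<dots> \<le> measure random_bits (E b)"
    proof (intro finite_measure_mono E subsetI)
      fix \<omega>
      assume \<omega>: "\<omega> \<in> {\<omega> \<in> space random_bits. correct copy_problem G (\<alpha> b) (online_output A d G (\<alpha> b) \<sigma> \<omega>)}"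
      then have "online_output A d G (\<alpha> b) \<sigma> \<omega> w = \<alpha> b 0"
        by (intro forced) simp
      then show "\<omega> \<in> E b"
        using \<omega> by (simp add: first E_def \<alpha>_def)
    qed
    finally show ?thesis .
  qed
  have "measure random_bits (E 0) + measure random_bits (E 1) = measure random_bits (E 0 \<union> E 1)"
    by (rule finite_measure_Union[symmetric]) (auto simp: E, auto simp: E_def)
  also have "\<dots> \<le> 1"
    by (rule prob_le_1)
  finally have "measure random_bits (E 0) + measure random_bits (E 1) \<le> 1" .
  moreover have "1 / 2 < measure random_bits (E 0)" "1 / 2 < measure random_bits (E 1)"
    by (rule half, simp)+
  ultimately show False
    by linarith
qed

theorem corollary4:
  shows "\<exists>P. locally_checkable P \<and>
    (\<forall>c\<ge>1. has_round_complexity c P (\<lambda>n. log 2 (log 2 (real n)))) \<and>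
    (\<forall>A d. online_algorithm A \<longrightarrow> solves_online P tree_graph A d \<longrightarrow>
       (\<lambda>n. real (d n)) \<in> \<Omega>(\<lambda>n. log 2 (log 2 (real n))))"
proof (intro exI[of _ copy_problem] conjI allI impI)
  show "locally_checkable copy_problem"
    by (rule locally_checkable_copy_problem)
next
  fix c :: nat
  assume "1 \<le> c"
  have "(\<lambda>n. real (round_complexity c copy_problem copy_algorithm n)) \<in> O(\<lambda>n. log 2 (log 2 (real n)))"
    by (intro bigo_loglogI round_complexity_copy_algorithm_le)
  moreover have "(\<lambda>n. real (round_complexity c copy_problem A n)) \<in> \<Omega>(\<lambda>n. log 2 (log 2 (real n)))"
    if "solves_local c copy_problem A" for A
    using le_round_complexity[OF that \<open>1 \<le> c\<close>] by (intro bigomega_loglogI always_eventually) blast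
  ultimately show "has_round_complexity c copy_problem (\<lambda>n. log 2 (log 2 (real n)))"
    unfolding has_round_complexity_def using solves_local_copy_algorithm by blast
next
  fix A d
  assume A: "online_algorithm A" and "solves_online copy_problem tree_graph A d"
  then obtain C :: real where C: "\<And>G \<alpha> \<sigma>. tree_graph G \<Longrightarrow> \<forall>v\<in>pverts G. \<alpha> v \<in> {0, 1} \<Longrightarrow>
      distinct \<sigma> \<Longrightarrow> set \<sigma> = pverts G \<Longrightarrow>
      1 - C / real (card (pverts G)) \<le> measure random_bits
        {\<omega> \<in> space random_bits. correct copy_problem G \<alpha> (online_output A d G \<alpha> \<sigma> \<omega>)}"
    unfolding solves_online_def in_labels_copy_problem by blast
  obtain n0 where "2 * C < real n0"
    using reals_Archimedean2 by blast
  then have "2 * C < real n" if "n0 \<le> n" for n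
    using that by linarith
  then have "eventually (\<lambda>n. 2 * C < real n) sequentially"
    by (rule eventually_sequentiallyI)
  then have "eventually (\<lambda>n. \<forall>k. 2 ^ 2 ^ (k + 2) \<le> n \<longrightarrow> k \<le> d n) sequentially"
    by eventually_elim (blast intro: le_online_locality[OF A C])
  then show "(\<lambda>n. real (d n)) \<in> \<Omega>(\<lambda>n. log 2 (log 2 (real n)))"
    by (rule bigomega_loglogI)
qed

end
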